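(* Let $f:\mathbb{R}^n\to\overline{\mathbb{R}}$ be a proper convex lower semicontinuous function and let $M\subset\mathbb{R}^n$ be a nonempty closed convex set. Suppose that $M$ has the strong separation property, that $f$ is bounded below on $M$, and that $f$ satisfies the condition: for every $v\neq0$ with $f^\infty(v)\le0$ there exists $\tilde x\in\operatorname{dom}f$ such that $\lim_{\lambda\to+\infty}f(\tilde x+\lambda v)=-\infty$. Then the solution set $$\operatorname{Sol}(M;f)=\{\bar x\in M: f(\bar x)=\inf_{x\in M}f(x)\}$$ of the problem of minimizing $f$ over $M$ is nonempty and compact.
   Context: $\overline{\mathbb{R}}=\mathbb{R}\cup\{\pm\infty\}$ and $\operatorname{dom}f=\{x: f(x)<+\infty\}$; $f$ is proper if it never takes the value $-\infty$ and $\operatorname{dom}f\ne\emptyset$. The horizon function of $f$ is $f^\infty(v)=\lim_{\lambda\to+\infty}\frac{f(x_0+\lambda v)-f(x_0)}{\lambda}$ for some $x_0\in\operatorname{dom}f$ (the limit does not depend on the choice of $x_0\in\operatorname{dom}f$). Convex sets $C,D\subset\mathbb{R}^n$ are strongly separated if there exists $x^*\in\mathbb{R}^n\setminus\{0\}$ with $\sup_{c\in C}\langle x^*,c\rangle<\inf_{d\in D}\langle x^*,d\rangle$. A convex subset of $\mathbb{R}^n$ has the strong separation property if it can be strongly separated from every other closed convex subset of $\mathbb{R}^n$ disjoint from it.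
   Formalization: The formal theorem also assumes that M meets dom f; without this the claim fails, e.g. for M=[0,∞) and f the indicator function of {-1}, where the infimum is +∞ and Sol(M;f)=M is not compact. *)

theory Defs
  imports "HOL-Analysis.Analysis"
begin

definition effective_domain :: "('a \<Rightarrow> ereal) \<Rightarrow> 'a set" where
  "effective_domain f = {x. f x < \<infinity>}"

definition proper_fun :: "('a \<Rightarrow> ereal) \<Rightarrow> bool" where
  "proper_fun f \<longleftrightarrow> (\<forall>x. f x \<noteq> -\<infinity>) \<and> effective_domain f \<noteq> {}"

text \<open>The library's \<^const>\<open>convex_on\<close> and \<^const>\<open>epigraph\<close> only cover real-valued functions; as usual, an
  extended-real-valued function is convex if its epigraph, a subset of the product with the
  real line, is convex.\<close>

definition convex_efun :: "('a::real_vector \<Rightarrow> ereal) \<Rightarrow> bool" where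
  "convex_efun f \<longleftrightarrow> convex {(x, r::real). f x \<le> ereal r}"

definition lower_semicontinuous :: "('a::topological_space \<Rightarrow> ereal) \<Rightarrow> bool" where
  "lower_semicontinuous f \<longleftrightarrow> (\<forall>x. f x \<le> Liminf (at x) f)"

text \<open>The base point is an arbitrary point of the effective domain. For proper convex \<open>f\<close> the
  limit exists, since the quotient is nondecreasing in \<open>t\<close>; if \<open>f\<close> is also lower
  semicontinuous, it does not depend on the base point.\<close>

definition horizon_fun :: "('a::real_vector \<Rightarrow> ereal) \<Rightarrow> 'a \<Rightarrow> ereal" where
  "horizon_fun f v =
     (let x0 = (SOME x. x \<in> effective_domain f)
      in Lim at_top (\<lambda>t::real. (f (x0 + t *\<^sub>R v) - f x0) / ereal t))"

definition strongly_separated :: "'a::real_inner set \<Rightarrow> 'a set \<Rightarrow> bool" where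
  "strongly_separated C D \<longleftrightarrow>
     (\<exists>a. a \<noteq> 0 \<and> (SUP c\<in>C. ereal (a \<bullet> c)) < (INF d\<in>D. ereal (a \<bullet> d)))"

text \<open>The sets to be separated from \<open>C\<close> are nonempty. Admitting the empty set would only
  exclude the whole space, on which no nonzero linear functional is bounded above.\<close>

definition strong_separation_property :: "'a::real_inner set \<Rightarrow> bool" where
  "strong_separation_property C \<longleftrightarrow> convex C \<and>
     (\<forall>D. D \<noteq> {} \<and> closed D \<and> convex D \<and> C \<inter> D = {} \<longrightarrow> strongly_separated C D)"

definition bounded_below_on :: "'a set \<Rightarrow> ('a \<Rightarrow> ereal) \<Rightarrow> bool" where
  "bounded_below_on M f \<longleftrightarrow> (\<exists>b::real. \<forall>x\<in>M. ereal b \<le> f x)"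

text \<open>If \<open>M\<close> does not meet the effective domain, the infimum is \<open>\<infinity>\<close> and \<open>Sol M f = M\<close>.\<close>

definition Sol :: "'a set \<Rightarrow> ('a \<Rightarrow> ereal) \<Rightarrow> 'a set" where
  "Sol M f = {x \<in> M. f x = (INF y\<in>M. f y)}"

end

theory Submission
  imports Defs
begin

text \<open>If a sublevel set of \<open>f\<close> on \<open>M\<close> were unbounded, it would contain a ray \<open>x0 + t v\<close>. Then
  \<open>f\<close> does not increase in the direction \<open>v\<close> from any point of its domain, so the horizon value is
  nonpositive and \<open>f\<close> tends to \<open>-\<infinity>\<close> on some ray \<open>x + t v\<close>. For a lower bound \<open>b\<close> of \<open>f\<close> on \<open>M\<close>, the
  set \<open>D\<close> of all points with \<open>f \<le> b - 1\<close> is thus nonempty, closed, convex and disjoint from \<open>M\<close>.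
  But it cannot be strongly separated from \<open>M\<close>: a functional bounded above on \<open>M\<close> does not increase
  along \<open>v\<close>, and since \<open>f\<close> is arbitrarily negative far out on the second ray, points of \<open>D\<close> occur on
  segments from \<open>x0\<close> to that ray arbitrarily close to \<open>x0\<close> in terms of the functional.\<close>

text \<open>Real upper bounds \<open>p\<close> and \<open>q\<close> stand in for values of
  \<open>f\<close>, so that convexity of the epigraph applies without arithmetic on infinite
  values.\<close>

lemma convex_efunD:
  assumes "convex_efun f" "f x \<le> ereal p" "f y \<le> ereal q" "0 \<le> t" "t \<le> 1"
  shows "f ((1 - t) *\<^sub>R x + t *\<^sub>R y) \<le> ereal ((1 - t) * p + t * q)"
proof -
  have "(1 - t) *\<^sub>R (x, p) + t *\<^sub>R (y, q) \<in> {(x, r::real). f x \<le> ereal r}"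
    using assms unfolding convex_efun_def by (intro convexD) auto
  then show ?thesis by simp
qed

lemma convex_sublevel:
  assumes "convex_efun f"
  shows "convex {x. f x \<le> ereal c}"
proof (rule convexI)
  fix x y and u v :: real
  assume *: "x \<in> {x. f x \<le> ereal c}" "y \<in> {x. f x \<le> ereal c}" "0 \<le> u" "0 \<le> v" "u + v = 1"
  then have u: "u = 1 - v" by simp
  have "(1 - v) * c + v * c = c" by (simp add: algebra_simps)
  then show "u *\<^sub>R x + v *\<^sub>R y \<in> {x. f x \<le> ereal c}"
    unfolding u using convex_efunD[OF assms, of x c y c v] * by simp
qed

lemma closed_sublevel:
  assumes "lower_semicontinuous f"
  shows "closed {x. f x \<le> c}"
proof -
  have "\<forall>\<^sub>F y in nhds x. c < f y" if "c < f x" for x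
  proof -
    have "c < Liminf (at x) f"
      using assms that unfolding lower_semicontinuous_def by (meson less_le_trans)
    then have "\<forall>\<^sub>F y in at x. c < f y"
      by (rule less_LiminfD)
    \<comment> \<open>The \<open>Liminf\<close> only controls a punctured neighbourhood; the centre
      is added by \<open>c < f x\<close>.\<close>
    then show ?thesis
      using that by (auto simp: eventually_at_filter elim: eventually_mono)
  qed
  then have "open {x. c < f x}"
    by (subst open_subopen) (simp add: eventually_nhds subset_eq)
  then show ?thesis
    by (simp add: closed_def Compl_eq not_le)
qed

text \<open>Unit vectors pointing from \<open>x0\<close> to points of \<open>S\<close> ever farther
  away accumulate at some \<open>v\<close>. The point at distance \<open>t\<close> in such a
  direction lies on the segment to its far point, hence in \<open>S\<close>, and closedness carries
  this over to \<open>v\<close>.\<close>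

lemma unbounded_closed_convex_contains_ray:
  fixes S :: "'a::euclidean_space set"
  assumes "closed S" "convex S" "\<not> bounded S" "x0 \<in> S"
  obtains v where "v \<noteq> 0" "\<And>t. 0 \<le> t \<Longrightarrow> x0 + t *\<^sub>R v \<in> S"
proof -
  have "\<exists>x\<in>S. real (Suc n) < norm (x - x0)" for n
  proof (rule ccontr)
    assume "\<not> ?thesis"
    then have "S \<subseteq> cball x0 (real (Suc n))"
      by (auto simp: dist_norm norm_minus_commute not_less)
    with \<open>\<not> bounded S\<close> show False
      using bounded_cball bounded_subset by blast
  qed
  then obtain x where xS: "x n \<in> S" and xn: "real (Suc n) < norm (x n - x0)" for n
    by metis
  define u where "u n = (x n - x0) /\<^sub>R norm (x n - x0)" for n
  have pos: "0 < norm (x n - x0)" for n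
    using xn[of n] by linarith
  have "\<forall>n. u n \<in> sphere 0 1"
    using pos by (auto simp: u_def)
  then obtain v r where v: "v \<in> sphere 0 1" "strict_mono r" "(u \<circ> r) \<longlonglongrightarrow> v"
    using compact_sphere[of "0::'a" 1] unfolding compact_def by metis
  have "x0 + t *\<^sub>R v \<in> S" if "0 \<le> t" for t
  proof (rule Lim_in_closed_set[OF \<open>closed S\<close>])
    show "((\<lambda>n. x0 + t *\<^sub>R (u \<circ> r) n) \<longlongrightarrow> x0 + t *\<^sub>R v) sequentially"
      by (intro tendsto_intros v)
    show "\<forall>\<^sub>F n in sequentially. x0 + t *\<^sub>R (u \<circ> r) n \<in> S"
      using eventually_ge_at_top[of "nat \<lceil>t\<rceil>"]
    proof eventually_elim
      case (elim n)
      let ?N = "norm (x (r n) - x0)"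
      have "t \<le> real n" using elim by linarith
      also have "\<dots> \<le> real (r n)" using v(2) seq_suble by auto
      finally have "t \<le> ?N" using xn[of "r n"] by simp
      then have "(1 - t / ?N) *\<^sub>R x0 + (t / ?N) *\<^sub>R x (r n) \<in> S"
        using pos[of "r n"] that assms xS by (intro convexD) auto
      also have "(1 - t / ?N) *\<^sub>R x0 + (t / ?N) *\<^sub>R x (r n) = x0 + t *\<^sub>R (u \<circ> r) n"
        by (simp add: u_def algebra_simps divide_inverse)
      finally show ?case .
    qed
  qed simp
  moreover have "v \<noteq> 0" using v(1) by auto
  ultimately show thesis using that by blast
qed

text \<open>On the segment from \<open>x\<close> to the far point \<open>x0 + m *\<^sub>R v\<close>,
  the weight \<open>s / m\<close> gives a point that tends to \<open>x + s *\<^sub>R v\<close> as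
  \<open>m\<close> grows. Convexity bounds \<open>f\<close> there by a quantity tending to
  \<open>r\<close>, and closed sublevel sets at levels \<open>r + e\<close> keep the bound in the
  limit.\<close>

lemma nonincreasing_along_bounded_ray:
  fixes f :: "'a::real_normed_vector \<Rightarrow> ereal"
  assumes "convex_efun f" "lower_semicontinuous f"
    and ray: "\<And>t. 0 \<le> t \<Longrightarrow> f (x0 + t *\<^sub>R v) \<le> ereal \<alpha>"
    and "f x \<le> ereal r" "0 \<le> s"
  shows "f (x + s *\<^sub>R v) \<le> ereal r"
proof (rule ereal_le_epsilon2)
  fix e :: real assume "0 < e"
  let ?y = "\<lambda>m. (1 - s / m) *\<^sub>R x + (s / m) *\<^sub>R (x0 + m *\<^sub>R v)"
  have sm: "((\<lambda>m. s / m) \<longlongrightarrow> 0) at_top"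
    by (rule real_tendsto_divide_at_top[OF tendsto_const filterlim_ident])
  have "((\<lambda>m. (1 - s / m) *\<^sub>R x + (s / m) *\<^sub>R x0 + s *\<^sub>R v)
      \<longlongrightarrow> (1 - 0) *\<^sub>R x + 0 *\<^sub>R x0 + s *\<^sub>R v) at_top"
    by (intro tendsto_intros sm)
  moreover have "\<forall>\<^sub>F m in at_top. (1 - s / m) *\<^sub>R x + (s / m) *\<^sub>R x0 + s *\<^sub>R v = ?y m"
    using eventually_gt_at_top[of 0] by eventually_elim (simp add: algebra_simps)
  ultimately have "(?y \<longlongrightarrow> (1 - 0) *\<^sub>R x + 0 *\<^sub>R x0 + s *\<^sub>R v) at_top"
    by (rule Lim_transform_eventually)
  then have lim: "(?y \<longlongrightarrow> x + s *\<^sub>R v) at_top" by simp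
  have "((\<lambda>m. (1 - s / m) * r + (s / m) * \<alpha>) \<longlongrightarrow> (1 - 0) * r + 0 * \<alpha>) at_top"
    by (intro tendsto_intros sm)
  then have "\<forall>\<^sub>F m in at_top. (1 - s / m) * r + (s / m) * \<alpha> < r + e"
    by (rule order_tendstoD) (use \<open>0 < e\<close> in simp)
  then have "\<forall>\<^sub>F m in at_top. ?y m \<in> {y. f y \<le> ereal (r + e)}"
    using eventually_gt_at_top[of 0] eventually_ge_at_top[of s]
  proof eventually_elim
    case (elim m)
    then have "f (?y m) \<le> ereal ((1 - s / m) * r + (s / m) * \<alpha>)"
      using assms by (intro convex_efunD) auto
    also have "\<dots> \<le> ereal (r + e)" using elim by simp
    finally show ?case by simp
  qed
  then have "x + s *\<^sub>R v \<in> {y. f y \<le> ereal (r + e)}"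
    using Lim_in_closed_set[OF closed_sublevel[OF assms(2)] _ _ lim] by simp
  then show "f (x + s *\<^sub>R v) \<le> ereal r + ereal e" by simp
qed

text \<open>\<open>Lim\<close> is a definite description, so the horizon value can be estimated only
  once convergence is known; monotone difference quotients supply it. The threshold \<open>a\<close>
  is there because those quotients are meaningful for positive \<open>t\<close> only.\<close>

lemma tendsto_SUP_at_top:
  fixes q :: "real \<Rightarrow> 'a::{complete_linorder, linorder_topology}"
  assumes "\<And>s t. a < s \<Longrightarrow> s \<le> t \<Longrightarrow> q s \<le> q t"
  shows "(q \<longlongrightarrow> (SUP t\<in>{a<..}. q t)) at_top"
proof (rule increasing_tendsto)
  show "\<forall>\<^sub>F t in at_top. q t \<le> (SUP t\<in>{a<..}. q t)"
    using eventually_gt_at_top[of a] by eventually_elim (auto intro: SUP_upper)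
next
  fix y assume "y < (SUP t\<in>{a<..}. q t)"
  then obtain s where "a < s" "y < q s" by (auto simp: less_SUP_iff)
  then show "\<forall>\<^sub>F t in at_top. y < q t"
    using assms less_le_trans unfolding eventually_at_top_linorder by blast
qed

text \<open>The base point of \<open>horizon_fun\<close> is an unspecified point of the domain,
  while the bounded ray starts at \<open>x0\<close>. By
  \<open>nonincreasing_along_bounded_ray\<close>, \<open>f\<close> stays below its base value along
  \<open>v\<close> from any base point, so all difference quotients and their supremum are
  nonpositive.\<close>

lemma horizon_fun_nonpos:
  fixes f :: "'a::real_normed_vector \<Rightarrow> ereal"
  assumes "proper_fun f" "convex_efun f" "lower_semicontinuous f"
    and ray: "\<And>t. 0 \<le> t \<Longrightarrow> f (x0 + t *\<^sub>R v) \<le> ereal \<alpha>"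
  shows "horizon_fun f v \<le> 0"
proof -
  define x where "x = (SOME x. x \<in> effective_domain f)"
  have "x \<in> effective_domain f"
    using assms(1) unfolding x_def proper_fun_def by (metis ex_in_conv someI_ex)
  then obtain r where r: "f x = ereal r"
    using assms(1) unfolding proper_fun_def effective_domain_def
    by (cases "f x") auto
  have le: "f (x + s *\<^sub>R v) \<le> ereal r" if "0 \<le> s" for s
    using nonincreasing_along_bounded_ray[OF assms(2,3) ray] r that by simp
  define h where "h s = real_of_ereal (f (x + s *\<^sub>R v))" for s
  have h: "f (x + s *\<^sub>R v) = ereal (h s)" if "0 \<le> s" for s
    using le[OF that] assms(1) unfolding h_def proper_fun_def
    by (cases "f (x + s *\<^sub>R v)") auto
  define q where "q t = (f (x + t *\<^sub>R v) - f x) / ereal t" for t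
  have q: "q t = ereal ((h t - r) / t)" if "0 < t" for t
    using that h[of t] by (simp add: q_def r)
  have "q s \<le> q t" if "0 < s" "s \<le> t" for s t
  proof -
    have "f ((1 - s / t) *\<^sub>R x + (s / t) *\<^sub>R (x + t *\<^sub>R v)) \<le> ereal ((1 - s / t) * r + (s / t) * h t)"
      using that r h[of t] by (intro convex_efunD assms) auto
    also have "(1 - s / t) *\<^sub>R x + (s / t) *\<^sub>R (x + t *\<^sub>R v) = x + s *\<^sub>R v"
      using that by (simp add: algebra_simps)
    finally have "h s \<le> (1 - s / t) * r + (s / t) * h t"
      using that h[of s] by simp
    then have "(h s - r) / s \<le> (h t - r) / t"
      using that by (simp add: field_simps)
    with that show ?thesis by (simp add: q)
  qed
  then have "(q \<longlongrightarrow> (SUP t\<in>{0<..}. q t)) at_top"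
    by (rule tendsto_SUP_at_top)
  then have "Lim at_top q = (SUP t\<in>{0<..}. q t)"
    by (intro tendsto_Lim) auto
  also have "\<dots> \<le> 0"
  proof (rule SUP_least)
    fix t :: real assume "t \<in> {0<..}"
    then show "q t \<le> 0"
      using le[of t] h[of t] q[of t] by (simp add: divide_nonpos_pos)
  qed
  finally show ?thesis
    unfolding horizon_fun_def Let_def x_def[symmetric] q_def .
qed

lemma bounded_sublevel_on:
  fixes f :: "'a::euclidean_space \<Rightarrow> ereal"
  assumes "proper_fun f" "convex_efun f" "lower_semicontinuous f"
    and "closed M" "convex M"
    and ssp: "strong_separation_property M"
    and "bounded_below_on M f"
    and dir: "\<And>v. v \<noteq> 0 \<Longrightarrow> horizon_fun f v \<le> 0 \<Longrightarrow>
           \<exists>x\<in>effective_domain f. ((\<lambda>t::real. f (x + t *\<^sub>R v)) \<longlongrightarrow> -\<infinity>) at_top"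
  shows "bounded (M \<inter> {x. f x \<le> ereal \<alpha>})"
proof (rule ccontr)
  let ?S = "M \<inter> {x. f x \<le> ereal \<alpha>}"
  assume unb: "\<not> bounded ?S"
  then obtain x0 where x0: "x0 \<in> ?S" by (metis bounded_empty ex_in_conv)
  obtain v where "v \<noteq> 0" and vS: "\<And>t. 0 \<le> t \<Longrightarrow> x0 + t *\<^sub>R v \<in> ?S"
    using unbounded_closed_convex_contains_ray[OF _ _ unb x0] assms(2-5)
    by (metis closed_Int closed_sublevel convex_Int convex_sublevel)
  then have "horizon_fun f v \<le> 0"
    using horizon_fun_nonpos[OF assms(1-3)] by blast
  with dir \<open>v \<noteq> 0\<close> obtain x where x: "((\<lambda>t. f (x + t *\<^sub>R v)) \<longlongrightarrow> -\<infinity>) at_top"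
    by blast
  have far: "\<exists>t\<ge>0. f (x + t *\<^sub>R v) \<le> ereal c" for c
  proof -
    have "\<forall>\<^sub>F t in at_top. f (x + t *\<^sub>R v) < ereal c"
      using x by (rule order_tendstoD) simp
    then have "\<forall>\<^sub>F t in at_top. 0 \<le> t \<and> f (x + t *\<^sub>R v) \<le> ereal c"
      using eventually_ge_at_top[of 0] by eventually_elim auto
    then show ?thesis
      using eventually_happens'[OF trivial_limit_at_top_linorder] by blast
  qed
  obtain b where b: "\<And>x. x \<in> M \<Longrightarrow> ereal b \<le> f x"
    using assms(7) unfolding bounded_below_on_def by blast
  let ?D = "{x. f x \<le> ereal (b - 1)}"
  have "M \<inter> ?D = {}"
  proof -
    have False if "y \<in> M" "f y \<le> ereal (b - 1)" for y
      using order_trans[OF b[OF that(1)] that(2)] by simp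
    then show ?thesis by blast
  qed
  moreover have "?D \<noteq> {}" using far by blast
  moreover have "strongly_separated M D" if "D \<noteq> {}" "closed D" "convex D" "M \<inter> D = {}" for D
    using ssp that unfolding strong_separation_property_def by blast
  ultimately have "strongly_separated M ?D"
    using closed_sublevel[OF assms(3)] convex_sublevel[OF assms(2)] by presburger
  then obtain a where "(SUP c\<in>M. ereal (a \<bullet> c)) < (INF d\<in>?D. ereal (a \<bullet> d))"
    unfolding strongly_separated_def by blast
  then obtain \<gamma> where "(SUP c\<in>M. ereal (a \<bullet> c)) < ereal \<gamma>" "ereal \<gamma> < (INF d\<in>?D. ereal (a \<bullet> d))"
    using ereal_dense2 by blast
  then have aM: "a \<bullet> c < \<gamma>" if "c \<in> M" for c
    using that by (metis SUP_lessD less_ereal.simps(1))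
  have aD: "\<gamma> < a \<bullet> d" if "d \<in> ?D" for d
    using less_INF_D[OF \<open>ereal \<gamma> < (INF d\<in>?D. ereal (a \<bullet> d))\<close> that] by simp
  have av: "a \<bullet> v \<le> 0"
  proof (rule ccontr)
    assume "\<not> a \<bullet> v \<le> 0"
    \<comment> \<open>At this \<open>t\<close> the functional would take exactly the value
      \<open>\<gamma>\<close> on the ray inside \<open>M\<close>, where it must stay strictly
      below.\<close>
    define t where "t = (\<gamma> - a \<bullet> x0) / (a \<bullet> v)"
    have "0 \<le> t"
      using \<open>\<not> a \<bullet> v \<le> 0\<close> aM[of x0] x0 by (simp add: t_def)
    then have "a \<bullet> (x0 + t *\<^sub>R v) < \<gamma>" using vS aM by blast
    then show False
      using \<open>\<not> a \<bullet> v \<le> 0\<close> by (simp add: t_def inner_add_right)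
  qed
  define \<delta> where "\<delta> = \<gamma> - a \<bullet> x0"
  have "0 < \<delta>" using aM x0 by (auto simp: \<delta>_def)
  \<comment> \<open>Moving the fraction \<open>s\<close> of the way from \<open>x0\<close> towards
    \<open>x\<close> raises the functional by at most the gap \<open>\<delta>\<close>. The
    \<open>+ 1\<close> keeps the denominator positive, and \<open>min 1\<close> makes
    \<open>s\<close> a convex weight.\<close>
  define s where "s = min 1 (\<delta> / (\<bar>a \<bullet> x - a \<bullet> x0\<bar> + 1))"
  have s: "0 < s" "s \<le> 1" using \<open>0 < \<delta>\<close> by (auto simp: s_def)
  have "s * (a \<bullet> x - a \<bullet> x0) \<le> s * (\<bar>a \<bullet> x - a \<bullet> x0\<bar> + 1)"
    using s by (intro mult_left_mono) auto
  also have "\<dots> \<le> \<delta> / (\<bar>a \<bullet> x - a \<bullet> x0\<bar> + 1) * (\<bar>a \<bullet> x - a \<bullet> x0\<bar> + 1)"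
    by (intro mult_right_mono) (auto simp: s_def)
  also have "\<dots> = \<delta>" by simp
  finally have s\<delta>: "s * (a \<bullet> x - a \<bullet> x0) \<le> \<delta>" .
  \<comment> \<open>With \<open>s\<close> fixed, this level solves
    \<open>(1 - s) * \<alpha> + s * c = b - 1\<close> for \<open>c\<close>, so that the convex
    combination below falls into \<open>?D\<close>. However large \<open>t\<close> has to be, its
    contribution \<open>s * t * (a \<bullet> v)\<close> to the functional is nonpositive.\<close>
  obtain t where t: "0 \<le> t" "f (x + t *\<^sub>R v) \<le> ereal ((b - 1 - (1 - s) * \<alpha>) / s)"
    using far by blast
  have "f ((1 - s) *\<^sub>R x0 + s *\<^sub>R (x + t *\<^sub>R v))
      \<le> ereal ((1 - s) * \<alpha> + s * ((b - 1 - (1 - s) * \<alpha>) / s))"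
    using x0 s t by (intro convex_efunD assms) auto
  also have "(1 - s) * \<alpha> + s * ((b - 1 - (1 - s) * \<alpha>) / s) = b - 1"
    using s by simp
  finally have "\<gamma> < a \<bullet> ((1 - s) *\<^sub>R x0 + s *\<^sub>R (x + t *\<^sub>R v))"
    by (intro aD) simp
  also have "\<dots> = a \<bullet> x0 + s * (a \<bullet> x - a \<bullet> x0) + s * t * (a \<bullet> v)"
    by (simp add: inner_add_right algebra_simps)
  also have "\<dots> \<le> a \<bullet> x0 + \<delta> + 0"
    using s\<delta> av s t by (intro add_mono mult_nonneg_nonpos) auto
  finally show False by (simp add: \<delta>_def)
qed

theorem theorem13:
  fixes f :: "real ^ 'n \<Rightarrow> ereal" and M :: "(real ^ 'n) set"
  assumes "proper_fun f" and "convex_efun f" and "lower_semicontinuous f"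
    and "M \<noteq> {}" and "closed M" and "convex M"
    and "M \<inter> effective_domain f \<noteq> {}"
    and "strong_separation_property M"
    and "bounded_below_on M f"
    and "\<And>v. v \<noteq> 0 \<Longrightarrow> horizon_fun f v \<le> 0 \<Longrightarrow>
           \<exists>x\<in>effective_domain f. ((\<lambda>t::real. f (x + t *\<^sub>R v)) \<longlongrightarrow> -\<infinity>) at_top"
  shows "Sol M f \<noteq> {} \<and> compact (Sol M f)"
proof -
  have compact: "compact (M \<inter> {x. f x \<le> ereal c})" for c
    using bounded_sublevel_on[OF assms(1-3,5,6,8-10)] closed_sublevel[OF assms(3)] assms(5)
    by (simp add: compact_eq_bounded_closed closed_Int)
  obtain b where "\<And>x. x \<in> M \<Longrightarrow> ereal b \<le> f x"
    using assms(9) unfolding bounded_below_on_def by blast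
  then have "ereal b \<le> (INF y\<in>M. f y)" by (rule INF_greatest)
  \<comment> \<open>Here \<open>M\<close> has to meet the effective domain: otherwise the infimum is
    infinite and \<open>Sol M f\<close> is all of \<open>M\<close>, which may be unbounded.\<close>
  moreover have "(INF y\<in>M. f y) < \<infinity>"
    using assms(7) unfolding effective_domain_def INF_less_iff by blast
  ultimately obtain m where m: "(INF y\<in>M. f y) = ereal m"
    by (cases "INF y\<in>M. f y") auto
  \<comment> \<open>As a sublevel set on \<open>M\<close>, the solution set is compact; it remains
    to find a point in it.\<close>
  have Sol: "Sol M f = M \<inter> {x. f x \<le> ereal m}"
    unfolding Sol_def m[symmetric] by (auto intro: antisym INF_lower)
  \<comment> \<open>Levels strictly above the infimum give nonempty, nested, compact sets. A common
    point is a minimizer because the levels decrease to \<open>m\<close>.\<close>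
  define F where "F n = M \<inter> {x. f x \<le> ereal (m + 1 / real (Suc n))}" for n
  have "F n \<noteq> {}" for n
  proof -
    have "(INF y\<in>M. f y) < ereal (m + 1 / real (Suc n))" by (simp add: m)
    then show ?thesis unfolding F_def INF_less_iff by (auto intro: less_imp_le)
  qed
  moreover have "F n \<subseteq> F k" if "k \<le> n" for k n
  proof -
    have "1 / real (Suc n) \<le> 1 / real (Suc k)" using that by (simp add: frac_le)
    then have "ereal (m + 1 / real (Suc n)) \<le> ereal (m + 1 / real (Suc k))" by simp
    then show ?thesis unfolding F_def using order_trans by blast
  qed
  ultimately have "\<Inter> (range F) \<noteq> {}"
    using compact by (intro compact_nest) (auto simp: F_def)
  moreover have "\<Inter> (range F) \<subseteq> Sol M f"
  proof
    fix x assume x: "x \<in> \<Inter> (range F)"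
    have "f x \<le> ereal m"
    proof (rule ereal_le_epsilon2)
      fix e :: real assume "0 < e"
      then obtain n where "1 / real (Suc n) < e"
        using nat_approx_posE by metis
      then have "ereal (m + 1 / real (Suc n)) \<le> ereal m + ereal e" by simp
      moreover have "f x \<le> ereal (m + 1 / real (Suc n))" using x by (auto simp: F_def)
      ultimately show "f x \<le> ereal m + ereal e" using order_trans by blast
    qed
    then show "x \<in> Sol M f" using x by (auto simp: Sol F_def)
  qed
  ultimately show ?thesis
    using compact by (auto simp: Sol)
qed

end
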